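(* Let $L\ge 0$, $\alpha>0$, $t_0\in\mathbb{R}$, and let $\mu:[t_0,+\infty)\to(0,+\infty)$ be a non-increasing function with $\lim_{t\to+\infty}\mu(t)=0$. Define $(t_k)_{k\ge 0}$ by $t_{k+1}=t_k+s_k$, where $\mu_k=\mu(t_k)$ and $s_k=1/L_k=1/(L+\alpha/\mu(t_k))$. Then $t_k-t_0=\sum_{\kappa=0}^{k-1}s_\kappa$ diverges to $+\infty$ as $k\to+\infty$, and $(\mu_k)$ is non-increasing with $\mu_k\to 0$.
   Context: In the paper, $\mu_k$ and $s_k$ are the smoothing parameter and the stepsize of the smoothing gradient method $x^{(k+1)}=x^{(k)}-s_k\nabla_x\widetilde F(x^{(k)},\mu_k)$, where $\widetilde F(\cdot,\mu)$ is $(L+\alpha/\mu)$-smooth; the claim concerns only the sequences $t_k,s_k,\mu_k$. *)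

theory Defs
  imports Complex_Main
begin

end

theory Submission
  imports Defs
begin

text \<open>
  A bounded sequence \<open>t\<close> would stay below some \<open>B\<close>. As \<open>\<mu>\<close> is non-increasing, all
  \<open>\<mu> (t k)\<close> would then be at least the positive number \<open>\<mu> B\<close>, and hence all steps at least
  \<open>1 / (L + \<alpha> / \<mu> B) > 0\<close>; but steps bounded away from zero make \<open>t\<close> exceed \<open>B\<close>. So \<open>t\<close> is
  unbounded, and since it is non-decreasing it tends to infinity. The behaviour of \<open>\<mu>k\<close> follows
  by composing \<open>\<mu>\<close> with \<open>t\<close>. The lemma \<open>filterlim_at_top_if_increments_bounded_below\<close> isolates the
  divergence argument: the steps may tend to zero, as long as they do so only where the sequence is
  large.
\<close>

text \<open>
  A lower bound on the increments that may depend on the level \<open>B\<close> suffices: below any fixed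
  level the sequence grows at least linearly, so it crosses that level, and monotonicity keeps it
  above from then on.
\<close>
lemma filterlim_at_top_if_increments_bounded_below:
  fixes t :: "nat \<Rightarrow> real"
  assumes mono: "incseq t"
    and step: "\<And>B. \<exists>c>0. \<forall>k. t k \<le> B \<longrightarrow> c \<le> t (Suc k) - t k"
  shows "filterlim t at_top sequentially"
proof -
  have crossing: "\<exists>k. B \<le> t k" for B
  proof (rule ccontr)
    assume "\<nexists>k. B \<le> t k"
    then have below: "t k \<le> B" for k
      by (meson linear)
    obtain c where "c > 0" and c: "\<And>k. c \<le> t (Suc k) - t k"
      using step[of B] below by blast
    have linear_growth: "t 0 + real k * c \<le> t k" for k
    proof (induction k)
      case (Suc k)
      then show ?case
        using c[of k] by (simp add: algebra_simps)
    qed simp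
    obtain n where "B - t 0 < real n * c"
      using reals_Archimedean3[OF \<open>c > 0\<close>] by blast
    then show False
      using linear_growth[of n] below[of n] by linarith
  qed
  show ?thesis
    unfolding filterlim_at_top eventually_sequentially
    using crossing mono by (meson incseqD order_trans)
qed

theorem proposition4:
  fixes L \<alpha> t\<^sub>0 :: real
    and \<mu> :: "real \<Rightarrow> real"
    and t s Lk \<mu>k :: "nat \<Rightarrow> real"
  assumes L: "L \<ge> 0"
    and \<alpha>: "\<alpha> > 0"
    and \<mu>_pos: "\<And>x. x \<in> {t\<^sub>0..} \<Longrightarrow> \<mu> x > 0"
    and \<mu>_noninc: "antimono_on {t\<^sub>0..} \<mu>"
    and \<mu>_lim: "(\<mu> \<longlongrightarrow> 0) at_top"
    and t_0: "t 0 = t\<^sub>0"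
    and t_Suc: "\<And>k. t (Suc k) = t k + s k"
    and \<mu>k: "\<And>k. \<mu>k k = \<mu> (t k)"
    and Lk: "\<And>k. Lk k = L + \<alpha> / \<mu> (t k)"
    and s: "\<And>k. s k = 1 / Lk k"
  shows "(\<forall>k. t k - t\<^sub>0 = (\<Sum>\<kappa><k. s \<kappa>))
    \<and> filterlim (\<lambda>k. t k - t\<^sub>0) at_top sequentially
    \<and> decseq \<mu>k
    \<and> \<mu>k \<longlonglongrightarrow> 0"
proof (intro conjI)
  have ge: "t k \<ge> t\<^sub>0" for k
  proof (induction k)
    case (Suc k)
    then show ?case
      using \<mu>_pos[of "t k"] L \<alpha> by (simp add: t_Suc s Lk add_increasing2)
  qed (simp add: t_0)
  then have \<mu>t_pos: "\<mu> (t k) > 0" for k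
    using \<mu>_pos by simp
  have Lk_pos: "Lk k > 0" for k
    using \<mu>t_pos[of k] L \<alpha> by (simp add: Lk add_nonneg_pos)
  have "incseq t"
    using Lk_pos by (intro incseq_SucI) (simp add: t_Suc s less_imp_le)
  show "\<forall>k. t k - t\<^sub>0 = (\<Sum>\<kappa><k. s \<kappa>)"
  proof
    show "t k - t\<^sub>0 = (\<Sum>\<kappa><k. s \<kappa>)" for k
      by (induction k) (auto simp: t_0 t_Suc algebra_simps)
  qed
  have t_at_top: "filterlim t at_top sequentially"
  proof (rule filterlim_at_top_if_increments_bounded_below[OF \<open>incseq t\<close>])
    fix B
    (* The maximum keeps the argument of \<mu> in its domain when B lies below the starting point. *)
    define b where "b = max B t\<^sub>0"
    define c where "c = 1 / (L + \<alpha> / \<mu> b)"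
    have "\<mu> b > 0"
      using \<mu>_pos by (simp add: b_def)
    then have "c > 0"
      using L \<alpha> by (simp add: c_def add_nonneg_pos)
    moreover have "c \<le> t (Suc k) - t k" if "t k \<le> B" for k
    proof -
      have "\<mu> b \<le> \<mu> (t k)"
        using \<mu>_noninc by (rule monotone_onD) (use ge that in \<open>auto simp: b_def\<close>)
      then have "Lk k \<le> L + \<alpha> / \<mu> b"
        using \<open>\<mu> b > 0\<close> \<alpha> by (simp add: Lk frac_le)
      then show ?thesis
        using Lk_pos[of k] by (simp add: t_Suc s c_def frac_le)
    qed
    ultimately show "\<exists>c>0. \<forall>k. t k \<le> B \<longrightarrow> c \<le> t (Suc k) - t k"
      by blast
  qed
  then show "filterlim (\<lambda>k. t k - t\<^sub>0) at_top sequentially"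
    using filterlim_tendsto_add_at_top[OF tendsto_const[of "- t\<^sub>0"]] by fastforce
  show "decseq \<mu>k"
    unfolding decseq_def \<mu>k
  proof (intro allI impI)
    show "\<mu> (t n) \<le> \<mu> (t m)" if "m \<le> n" for m n
      using \<mu>_noninc by (rule monotone_onD) (use ge incseqD[OF \<open>incseq t\<close> that] in auto)
  qed
  show "\<mu>k \<longlonglongrightarrow> 0"
    using filterlim_compose[OF \<mu>_lim t_at_top] unfolding \<mu>k[abs_def] .
qed

end
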